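(* Let $E\ge2$ be an integer and let $P=(p_{ij})_{i,j\in\mathbb{Z}^+}$ be the matrix with $p_{ij}=\frac{1}{E^{\ell(i,E)}+1}$ if $1\le j\le E^{\ell(i,E)}+1$ and $p_{ij}=0$ otherwise, where $\ell(i,E)=\inf\{n\in\mathbb{Z}^+: i\le E^n\}$. Let $(q_n)_{n\ge1}$ be given by $q_1=\frac12$ and $q_{k+1}=\frac{E}{E^k+1}q_k$ for $k\in\mathbb{Z}^+$. Then the only stochastic infinite-dimensional row vector $p=(p_1,p_2,\dots)$ with $p=pP$ is given by $$p_k=\begin{cases}\frac{1}{2E} & \text{if } k\in\{1,\dots,E+1\},\\ \frac{1}{E^n}q_n & \text{if } n>1 \text{ and } k\in\{E^{n-1}+2,\dots,E^n+1\}.\end{cases}$$ Equivalently, this $p$ is the only stationary distribution of the Markov chain defined by $P$.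
   Context: A row vector is stochastic if its entries are non-negative and sum to $1$. A stationary distribution of a Markov chain with transition matrix $P$ is a stochastic row vector $p$ with $pP=p$. *)

theory Defs
  imports "HOL-Analysis.Infinite_Sum"
begin

text \<open>
  Row vectors and matrices indexed by the positive integers are functions on \<^typ>\<open>nat\<close>
  of which only the values at indices \<open>\<ge> 1\<close> matter; two such vectors are identified
  when they agree on \<open>{1..}\<close>.
\<close>

definition stochastic_row :: "(nat \<Rightarrow> real) \<Rightarrow> bool" where
  "stochastic_row p \<longleftrightarrow> (\<forall>k\<ge>1. 0 \<le> p k) \<and> (p has_sum 1) {1..}"

definition stochastic_matrix :: "(nat \<Rightarrow> nat \<Rightarrow> real) \<Rightarrow> bool" where
  "stochastic_matrix P \<longleftrightarrow> (\<forall>i\<ge>1. stochastic_row (P i))"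

text \<open>
  The sum below converges absolutely whenever \<open>p\<close> is stochastic and the entries of \<open>P\<close> are
  bounded, so the default value of \<^const>\<open>infsum\<close> plays no role in what follows.
\<close>

definition row_times :: "(nat \<Rightarrow> real) \<Rightarrow> (nat \<Rightarrow> nat \<Rightarrow> real) \<Rightarrow> nat \<Rightarrow> real" where
  "row_times p P j = (\<Sum>\<^sub>\<infinity>i\<in>{1..}. p i * P i j)"

text \<open>
  A Markov chain on the positive integers is represented by its transition matrix, which has to
  be stochastic.
\<close>

definition stationary_distribution :: "(nat \<Rightarrow> nat \<Rightarrow> real) \<Rightarrow> (nat \<Rightarrow> real) \<Rightarrow> bool" where
  "stationary_distribution P p \<longleftrightarrow>
     stochastic_matrix P \<and> stochastic_row p \<and> (\<forall>j\<ge>1. row_times p P j = p j)"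

definition ell :: "nat \<Rightarrow> nat \<Rightarrow> nat" where
  "ell i E = Inf {n. 1 \<le> n \<and> i \<le> E ^ n}"

definition P_mat :: "nat \<Rightarrow> nat \<Rightarrow> nat \<Rightarrow> real" where
  "P_mat E i j =
     (if 1 \<le> j \<and> j \<le> E ^ ell i E + 1 then 1 / (real E ^ ell i E + 1) else 0)"

end

theory Submission
  imports Defs
begin

text \<open>
  The entry \<open>P i j\<close> depends only on \<open>ell i E\<close> and on whether \<open>ell (j - 1) E \<le> ell i E\<close>. Hence an
  invariant row \<open>r\<close> has the form \<open>r j = s (ell (j - 1) E)\<close>, where \<open>s m - s (m + 1)\<close> is the
  mass of the block \<open>{i. ell i E = m}\<close> divided by \<open>E ^ m + 1\<close>. Inductively that mass is
  \<open>E ^ m * s m\<close>, so \<open>s (m + 1) = s m / (E ^ m + 1)\<close> and \<open>r\<close> is determined up to a scalar.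
  Conversely, this recursion makes both the sum of the entries and the invariance equations
  telescope over the blocks, because \<open>E ^ (m + 1) * s (m + 1) = E * (s m - s (m + 1))\<close>.
\<close>

section \<open>Levels of indices: blocks and tails\<close>

definition level_block :: "nat \<Rightarrow> nat \<Rightarrow> nat set" where
  "level_block E n = {i. 1 \<le> i \<and> ell i E = n}"

definition level_tail :: "nat \<Rightarrow> nat \<Rightarrow> nat set" where
  "level_tail E m = {i. 1 \<le> i \<and> m \<le> ell i E}"

text \<open>An infimum on \<open>nat\<close> is attained only on a nonempty set. The witness is
  \<open>Suc i\<close> rather than \<open>i\<close>, so that it is at least 1 even for
  \<open>i = 0\<close>, a value that occurs as \<open>j - 1\<close> for the first column.\<close>

lemma ell_set_nonempty:
  fixes E i :: nat
  assumes "E \<ge> 2"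
  shows "{n. 1 \<le> n \<and> i \<le> E ^ n} \<noteq> {}"
proof -
  have "Suc i < E ^ Suc i"
    using assms by (intro power_gt_expt) simp
  then have "Suc i \<in> {n. 1 \<le> n \<and> i \<le> E ^ n}"
    by simp
  then show ?thesis by blast
qed

lemma ell_in:
  assumes "E \<ge> 2"
  shows "1 \<le> ell i E" and "i \<le> E ^ ell i E"
  using Inf_nat_def1[OF ell_set_nonempty[OF assms, of i]] by (simp_all add: ell_def)

lemma ell_le_iff:
  assumes "E \<ge> 2" "n \<ge> 1"
  shows "ell i E \<le> n \<longleftrightarrow> i \<le> E ^ n"
proof
  assume "ell i E \<le> n"
  then have "E ^ ell i E \<le> E ^ n"
    using assms by (intro power_increasing) auto
  then show "i \<le> E ^ n"
    using ell_in(2)[OF assms(1), of i] by linarith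
next
  assume "i \<le> E ^ n"
  then show "ell i E \<le> n"
    unfolding ell_def using assms(2) by (intro wellorder_Inf_le1) simp
qed

lemma ell_eq_one:
  assumes "E \<ge> 2" "i \<le> E"
  shows "ell i E = 1"
  using ell_le_iff[OF assms(1), of 1 i] ell_in(1)[OF assms(1), of i] assms(2) by simp

lemma ell_eq_Suc:
  assumes "E \<ge> 2" "n \<ge> 1" "E ^ n < i" "i \<le> E ^ Suc n"
  shows "ell i E = Suc n"
  using ell_le_iff[OF assms(1,2), of i] ell_le_iff[OF assms(1), of "Suc n" i] assms(3,4) by simp

lemma ell_power:
  assumes "E \<ge> 2" "n \<ge> 1"
  shows "ell (E ^ n) E = n"
proof (cases "n = 1")
  case True
  then show ?thesis using ell_eq_one[OF assms(1), of E] by simp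
next
  case False
  then obtain m where m: "n = Suc m" "m \<ge> 1"
    using assms(2) by (cases n) auto
  have "E ^ m < E ^ Suc m"
    using assms(1) by (intro power_strict_increasing) auto
  then show ?thesis using ell_eq_Suc[OF assms(1) m(2)] m(1) by simp
qed

lemma level_block_one:
  assumes "E \<ge> 2"
  shows "level_block E 1 = {1..E}"
proof (intro set_eqI iffI)
  fix i
  assume "i \<in> level_block E 1"
  then show "i \<in> {1..E}"
    using ell_in(2)[OF assms, of i] by (simp add: level_block_def)
qed (simp add: level_block_def ell_eq_one[OF assms])

lemma level_block_Suc:
  assumes "E \<ge> 2" "n \<ge> 1"
  shows "level_block E (Suc n) = {E ^ n + 1..E ^ Suc n}"
proof (intro set_eqI iffI)
  fix i
  assume "i \<in> level_block E (Suc n)"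
  then have "ell i E = Suc n" by (simp add: level_block_def)
  then show "i \<in> {E ^ n + 1..E ^ Suc n}"
    using ell_le_iff[OF assms, of i] ell_in(2)[OF assms(1), of i] by simp
next
  fix i
  assume "i \<in> {E ^ n + 1..E ^ Suc n}"
  then show "i \<in> level_block E (Suc n)"
    using ell_eq_Suc[OF assms, of i] by (simp add: level_block_def)
qed

lemma finite_level_block:
  assumes "E \<ge> 2"
  shows "finite (level_block E n)"
  by (rule finite_subset[of _ "{..E ^ n}"]) (use ell_in(2)[OF assms] in \<open>auto simp: level_block_def\<close>)

lemma level_tail_one:
  assumes "E \<ge> 2"
  shows "level_tail E 1 = {1..}"
  using ell_in(1)[OF assms] by (auto simp: level_tail_def)

lemma level_tail_split:
  "level_tail E m = level_block E m \<union> level_tail E (Suc m)"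
  "level_block E m \<inter> level_tail E (Suc m) = {}"
  by (auto simp: level_tail_def level_block_def)

section \<open>The transition matrix in terms of levels\<close>

text \<open>For positive \<open>j\<close>, the bound \<open>j \<le> E ^ ell i E + 1\<close> says
  \<open>j - 1 \<le> E ^ ell i E\<close>, which \<open>ell_le_iff\<close> turns into a comparison of
  levels. This is the source of the shift from \<open>j\<close> to \<open>j - 1\<close> everywhere
  below.\<close>

lemma P_mat_ell:
  assumes "E \<ge> 2"
  shows "P_mat E i j = (if 1 \<le> j \<and> ell (j - 1) E \<le> ell i E then 1 / (real E ^ ell i E + 1) else 0)"
  using ell_le_iff[OF assms ell_in(1)[OF assms], of "j - 1" i] by (auto simp: P_mat_def)

lemma stochastic_matrix_P_mat: "stochastic_matrix (P_mat E)"
  unfolding stochastic_matrix_def stochastic_row_def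
proof (intro allI impI conjI)
  fix i
  have "(P_mat E i has_sum sum (P_mat E i) {1..E ^ ell i E + 1}) {1..E ^ ell i E + 1}"
    by (intro has_sum_finite) simp
  also have "?this \<longleftrightarrow> (P_mat E i has_sum sum (P_mat E i) {1..E ^ ell i E + 1}) {1..}"
    by (intro has_sum_cong_neutral) (auto simp: P_mat_def)
  also have "sum (P_mat E i) {1..E ^ ell i E + 1} = (\<Sum>j\<in>{1..E ^ ell i E + 1}. 1 / (real E ^ ell i E + 1))"
    by (intro sum.cong) (auto simp: P_mat_def)
  also have "\<dots> = 1"
  proof -
    have "real E ^ ell i E + 1 > 0" by (simp add: add_nonneg_pos)
    then show ?thesis by (simp add: add.commute)
  qed
  finally show "(P_mat E i has_sum 1) {1..}" .
qed (simp add: P_mat_def)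

lemma row_times_P_mat:
  assumes "E \<ge> 2" "j \<ge> 1"
  shows "row_times r (P_mat E) j = (\<Sum>\<^sub>\<infinity>i\<in>level_tail E (ell (j - 1) E). r i / (real E ^ ell i E + 1))"
  unfolding row_times_def P_mat_ell[OF assms(1)]
  by (rule infsum_cong_neutral) (use assms in \<open>auto simp: level_tail_def\<close>)

text \<open>Blocks are cut by the level of \<open>k\<close>, but \<open>r k\<close> depends on the
  level of \<open>k - 1\<close>; so in a block with \<open>n > 1\<close> exactly the first entry
  carries the value of the preceding level. Only the recurrence step leading into \<open>n\<close>
  is assumed, which lets the lemma be used inside an induction that is still establishing the
  recurrence.\<close>

lemma sum_level_block:
  fixes r s :: "nat \<Rightarrow> real"
  assumes E: "E \<ge> 2" and n: "n \<ge> 1"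
    and r: "\<And>k. k \<ge> 1 \<Longrightarrow> r k = s (ell (k - 1) E)"
    and s: "\<And>m. n = Suc m \<Longrightarrow> m \<ge> 1 \<Longrightarrow> s n = s m / (real E ^ m + 1)"
  shows "sum r (level_block E n) = real E ^ n * s n"
proof (cases "n = 1")
  case True
  have "sum r {1..E} = (\<Sum>k\<in>{1..E}. s 1)"
    by (intro sum.cong refl) (use ell_eq_one[OF E] r in auto)
  then show ?thesis using True level_block_one[OF E] by simp
next
  case False
  then obtain m where m: "n = Suc m" "m \<ge> 1"
    using n by (cases n) auto
  have lt: "E ^ m + 1 \<le> E ^ n"
    unfolding Suc_eq_plus1[symmetric] m(1) Suc_le_eq using E by (intro power_strict_increasing) auto
  have eq: "level_block E n = insert (E ^ m + 1) {E ^ m + 2..E ^ n}"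
    using level_block_Suc[OF E m(2)] atLeastAtMost_insertL[OF lt] by (simp add: m(1))
  have rest: "r k = s n" if "k \<in> {E ^ m + 2..E ^ n}" for k
  proof -
    have "ell (k - 1) E = n"
      using that unfolding m(1) by (intro ell_eq_Suc[OF E m(2)]) auto
    then show ?thesis using that r[of k] by simp
  qed
  have "r (E ^ m + 1) = s m"
    using r[of "E ^ m + 1"] ell_power[OF E m(2)] by simp
  then have "sum r (level_block E n) = s m + real (E ^ n - (E ^ m + 1)) * s n"
    using rest by (simp add: eq)
  \<comment> \<open>The first entry weighs as much as \<open>E ^ m + 1\<close> entries of value
    \<open>s n\<close>. That compensates exactly for the \<open>E ^ m + 1\<close> missing from the
    count of the remaining entries.\<close>
  also have "s m = (real E ^ m + 1) * s n"
  proof -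
    have "real E ^ m + 1 > 0" by (simp add: add_nonneg_pos)
    then show ?thesis using s[OF m] by simp
  qed
  also have "real (E ^ n - (E ^ m + 1)) = real E ^ n - (real E ^ m + 1)"
    using lt by (subst of_nat_diff) auto
  finally show ?thesis by (simp add: algebra_simps)
qed

section \<open>Infinite sums by exhaustion and telescoping\<close>

text \<open>Every finite subset of \<open>A\<close> lies in some \<open>T N\<close>, so all finite
  sums are bounded by \<open>L\<close> and \<open>f\<close> is summable. Its sum is then the limit
  along the particular sequence \<open>T\<close>, hence \<open>L\<close>.\<close>

lemma has_sum_exhaustion:
  fixes f :: "'a \<Rightarrow> real"
  assumes nonneg: "\<And>x. x \<in> A \<Longrightarrow> 0 \<le> f x"
    and fin: "\<And>N. finite (T N)" and inc: "incseq T" and un: "(\<Union>N. T N) = A"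
    and lim: "(\<lambda>N::nat. sum f (T N)) \<longlonglongrightarrow> L"
  shows "(f has_sum L) A"
proof -
  have TA: "T N \<subseteq> A" for N using un by blast
  have flim: "filterlim T (finite_subsets_at_top A) sequentially"
    unfolding filterlim_finite_subsets_at_top
  proof (intro allI impI)
    fix F assume F: "finite F \<and> F \<subseteq> A"
    have "finite F" "F \<subseteq> A" using F by auto
    then have "\<exists>N. F \<subseteq> T N"
    proof (induction F rule: finite_induct)
      case (insert x F)
      then obtain N M where "F \<subseteq> T N" "x \<in> T M"
        using un by blast
      then have "insert x F \<subseteq> T (max N M)"
        using incseqD[OF inc, of N "max N M"] incseqD[OF inc, of M "max N M"] by auto
      then show ?case ..
    qed simp
    then obtain N where "F \<subseteq> T N" ..
    then show "\<forall>\<^sub>F N in sequentially. finite (T N) \<and> F \<subseteq> T N \<and> T N \<subseteq> A"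
      unfolding eventually_sequentially using fin TA incseqD[OF inc] by blast
  qed
  have "incseq (\<lambda>N. sum f (T N))"
    using fin nonneg TA incseqD[OF inc] by (intro monoI sum_mono2) blast+
  then have bound: "sum f (T N) \<le> L" for N
    using lim by (rule incseq_le)
  have "f summable_on A"
  proof (rule nonneg_bdd_above_summable_on)
    show "bdd_above (sum f ` {F. F \<subseteq> A \<and> finite F})"
    proof (rule bdd_aboveI2[of _ _ L])
      fix F assume F: "F \<in> {F. F \<subseteq> A \<and> finite F}"
      then have "\<forall>\<^sub>F N in sequentially. F \<subseteq> T N"
        using flim unfolding filterlim_finite_subsets_at_top
        by (auto elim!: allE[of _ F] eventually_mono)
      then obtain N where "F \<subseteq> T N"
        by (auto dest: eventually_happens)
      then have "sum f F \<le> sum f (T N)"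
        using fin nonneg TA by (intro sum_mono2) blast+
      then show "sum f F \<le> L" using bound[of N] by linarith
    qed
  qed (use nonneg in blast)
  then have "(f has_sum infsum f A) A" by (rule has_sum_infsum)
  moreover from this have "(\<lambda>N. sum f (T N)) \<longlonglongrightarrow> infsum f A"
    unfolding has_sum_def using flim by (rule filterlim_compose)
  then have "infsum f A = L"
    using lim LIMSEQ_unique by blast
  ultimately show ?thesis by simp
qed

text \<open>The tail is exhausted by the first \<open>N\<close> blocks from level \<open>m\<close>
  on, whose sum telescopes to \<open>u m - u (m + N)\<close>. Thus \<open>u n\<close> is the mass
  lying at levels \<open>n\<close> and above.\<close>

lemma has_sum_level_tail_telescope:
  fixes f u :: "nat \<Rightarrow> real"
  assumes E: "E \<ge> 2"
    and nonneg: "\<And>i. i \<ge> 1 \<Longrightarrow> 0 \<le> f i"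
    and blk: "\<And>n. n \<ge> m \<Longrightarrow> sum f (level_block E n) = u n - u (Suc n)"
    and u: "u \<longlonglongrightarrow> 0"
  shows "(f has_sum u m) (level_tail E m)"
proof (rule has_sum_exhaustion)
  define T where "T N = {i. 1 \<le> i \<and> m \<le> ell i E \<and> ell i E < m + N}" for N
  have T_Suc: "T (Suc N) = T N \<union> level_block E (m + N)" "T N \<inter> level_block E (m + N) = {}" for N
    by (auto simp: T_def level_block_def)
  have T_0: "T 0 = {}" by (auto simp: T_def)
  show fin: "finite (T N)" for N
    by (induction N) (simp_all add: T_0 T_Suc finite_level_block[OF E])
  show "incseq T" by (auto simp: incseq_def T_def)
  show "(\<Union>N. T N) = level_tail E m"
  proof (intro set_eqI iffI)
    fix i assume i: "i \<in> level_tail E m"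
    then have "i \<in> T (Suc (ell i E))" by (simp add: T_def level_tail_def)
    then show "i \<in> (\<Union>N. T N)" by blast
  qed (auto simp: T_def level_tail_def)
  have "sum f (T N) = u m - u (N + m)" for N
  proof (induction N)
    case (Suc N)
    have "sum f (T (Suc N)) = sum f (T N) + sum f (level_block E (m + N))"
      unfolding T_Suc(1) by (intro sum.union_disjoint fin finite_level_block[OF E] T_Suc(2))
    then show ?case using Suc.IH blk[of "m + N"] by (simp add: add.commute)
  qed (simp add: T_0)
  moreover have "(\<lambda>N. u m - u (N + m)) \<longlonglongrightarrow> u m - 0"
    by (intro tendsto_diff tendsto_const LIMSEQ_ignore_initial_segment u)
  ultimately show "(\<lambda>N. sum f (T N)) \<longlonglongrightarrow> u m" by simp
qed (use nonneg in \<open>simp add: level_tail_def\<close>)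

section \<open>Invariant rows satisfy the level recurrence\<close>

lemma invariant_row_levels:
  fixes r :: "nat \<Rightarrow> real"
  assumes E: "E \<ge> 2" and stoch: "stochastic_row r"
    and inv: "\<And>j. j \<ge> 1 \<Longrightarrow> r j = row_times r (P_mat E) j"
  obtains s where "\<And>k. k \<ge> 1 \<Longrightarrow> r k = s (ell (k - 1) E)"
    and "\<And>n. n \<ge> 1 \<Longrightarrow> s (Suc n) = s n / (real E ^ n + 1)"
proof -
  define g where "g i = r i / (real E ^ ell i E + 1)" for i
  define s where "s m = infsum g (level_tail E m)" for m
  have r: "r k = s (ell (k - 1) E)" if "k \<ge> 1" for k
    unfolding s_def g_def using inv[OF that] row_times_P_mat[OF E that] by simp
  have nonneg: "0 \<le> r i" if "i \<ge> 1" for i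
    using stoch that by (simp add: stochastic_row_def)
  have "r summable_on {1..}"
    using stoch has_sum_imp_summable by (auto simp: stochastic_row_def)
  \<comment> \<open>The weights \<open>1 / (real E ^ ell i E + 1)\<close> are at most 1. Summability
    is what makes the infinite sum over a tail split into block plus smaller tail.\<close>
  then have "g summable_on {1..}"
  proof (rule summable_on_comparison_test)
    show "g i \<le> r i" "0 \<le> g i" if "i \<in> {1..}" for i
      using nonneg[of i] that divide_left_mono[of 1 "real E ^ ell i E + 1" "r i"]
      by (simp_all add: g_def add_nonneg_pos)
  qed
  then have g: "g summable_on level_tail E m" for m
    by (rule summable_on_subset_banach) (auto simp: level_tail_def)
  have diff: "s m - s (Suc m) = sum r (level_block E m) / (real E ^ m + 1)" for m
  proof -
    have "s m = infsum g (level_block E m) + s (Suc m)"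
      unfolding s_def
      by (subst level_tail_split(1), intro infsum_Un_disjoint level_tail_split(2) g)
        (simp add: finite_level_block[OF E])
    also have "infsum g (level_block E m) = sum r (level_block E m) / (real E ^ m + 1)"
      unfolding infsum_finite[OF finite_level_block[OF E]] sum_divide_distrib
      by (intro sum.cong) (auto simp: g_def level_block_def)
    finally show ?thesis by simp
  qed
  have "s (Suc n) = s n / (real E ^ n + 1)" if "n \<ge> 1" for n
    using that
  \<comment> \<open>The mass of block \<open>n\<close> requires the recurrence at the predecessor of
    \<open>n\<close>; for \<open>n = 1\<close> there is no predecessor of positive level, so no
    separate base case arises.\<close>
  proof (induction n rule: less_induct)
    case (less n)
    have "sum r (level_block E n) = real E ^ n * s n"
      by (rule sum_level_block[OF E less.prems, where s = s]) (use less.IH r in auto)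
    then have "s n - s (Suc n) = real E ^ n * s n / (real E ^ n + 1)"
      using diff[of n] by simp
    moreover have "real E ^ n + 1 > 0" by (simp add: add_nonneg_pos)
    ultimately show ?case by (simp add: field_simps)
  qed
  then show ?thesis using that[of s] r by blast
qed

section \<open>Solutions of the level recurrence\<close>

lemma level_recurrence_proportional:
  fixes s t :: "nat \<Rightarrow> real"
  assumes "\<And>n. n \<ge> 1 \<Longrightarrow> s (Suc n) = s n / a n" "\<And>n. n \<ge> 1 \<Longrightarrow> t (Suc n) = t n / a n"
    and "s 1 = c * t 1" and "n \<ge> 1"
  shows "s n = c * t n"
  using assms(4) by (induction n rule: dec_induct) (use assms(1-3) in simp_all)

text \<open>For \<open>n \<ge> 1\<close> the divisor \<open>real E ^ n + 1\<close> is at least 2, so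
  each step at least halves the value. The geometric bound starts at \<open>s 1\<close>, as the
  recurrence leaves \<open>s 0\<close> arbitrary.\<close>

lemma level_recurrence_nonneg_tendsto:
  fixes s :: "nat \<Rightarrow> real"
  assumes E: "E \<ge> 2" and s1: "s 1 \<ge> 0"
    and s: "\<And>n. n \<ge> 1 \<Longrightarrow> s (Suc n) = s n / (real E ^ n + 1)"
  shows "n \<ge> 1 \<Longrightarrow> s n \<ge> 0" and "s \<longlonglongrightarrow> 0"
proof -
  show nonneg: "s n \<ge> 0" if "n \<ge> 1" for n
    using that by (induction n rule: dec_induct) (use s1 in \<open>simp_all add: s\<close>)
  have bound: "s (Suc n) \<le> s 1 * (1 / 2) ^ n" for n
  proof (induction n)
    case (Suc n)
    have "real E ^ Suc n \<ge> 1" using E by (intro one_le_power) simp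
    then have "s (Suc (Suc n)) \<le> s (Suc n) / 2"
      unfolding s[of "Suc n", simplified] using nonneg[of "Suc n"]
      by (intro divide_left_mono) auto
    with Suc.IH show ?case by simp
  qed simp
  have "(\<lambda>n. s 1 * (1 / 2) ^ n) \<longlonglongrightarrow> s 1 * 0"
    by (intro tendsto_mult_left LIMSEQ_realpow_zero) auto
  then have lim: "(\<lambda>n. s 1 * (1 / 2) ^ n) \<longlonglongrightarrow> 0" by simp
  have "(\<lambda>n. s (Suc n)) \<longlonglongrightarrow> 0"
  proof (rule real_tendsto_sandwich[OF _ _ tendsto_const lim])
    show "\<forall>\<^sub>F n in sequentially. 0 \<le> s (Suc n)"
      by (rule always_eventually) (simp add: nonneg)
    show "\<forall>\<^sub>F n in sequentially. s (Suc n) \<le> s 1 * (1 / 2) ^ n"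
      by (rule always_eventually) (rule allI, rule bound)
  qed
  then show "s \<longlonglongrightarrow> 0" by (simp add: filterlim_sequentially_Suc)
qed

section \<open>The solution is a stochastic invariant row\<close>

lemma level_row_invariant:
  fixes p s :: "nat \<Rightarrow> real"
  assumes E: "E \<ge> 2" and s1: "s 1 = 1 / (2 * real E)"
    and s: "\<And>n. n \<ge> 1 \<Longrightarrow> s (Suc n) = s n / (real E ^ n + 1)"
    and p: "\<And>k. k \<ge> 1 \<Longrightarrow> p k = s (ell (k - 1) E)"
  shows "stochastic_row p" and "j \<ge> 1 \<Longrightarrow> row_times p (P_mat E) j = p j"
proof -
  have s_nonneg: "s n \<ge> 0" if "n \<ge> 1" for n
    using level_recurrence_nonneg_tendsto(1)[OF E _ s that] s1 by simp
  have s_lim: "s \<longlonglongrightarrow> 0"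
    using level_recurrence_nonneg_tendsto(2)[OF E _ s] s1 by simp
  have p_nonneg: "0 \<le> p k" if "k \<ge> 1" for k
    using p[OF that] s_nonneg ell_in(1)[OF E] by simp
  have blk: "sum p (level_block E n) = real E ^ n * s n" if "n \<ge> 1" for n
    by (rule sum_level_block[OF E that, where s = s]) (use s p in auto)
  have s_diff: "s n - s (Suc n) = real E ^ n * s (Suc n)" if "n \<ge> 1" for n
  proof -
    have "real E ^ n + 1 > 0" by (simp add: add_nonneg_pos)
    then show ?thesis using s[OF that] by (simp add: field_simps)
  qed
  \<comment> \<open>Candidate tail masses: \<open>s_diff\<close> multiplied by \<open>real E\<close>
    gives block \<open>n > 1\<close> the mass \<open>real E * (s (n - 1) - s n)\<close>. For
    \<open>n = 1\<close> telescoping to total mass 1 requires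
    \<open>1 - real E * s 1 = real E * s 1\<close>, which is the normalisation
    \<open>s1\<close>.\<close>
  define u where "u n = (if n \<le> 1 then 1 else real E * s (n - 1))" for n
  have "(p has_sum u 1) (level_tail E 1)"
  proof (rule has_sum_level_tail_telescope[OF E p_nonneg])
    fix n :: nat
    assume n: "1 \<le> n"
    show "sum p (level_block E n) = u n - u (Suc n)"
    proof (cases "n = 1")
      case True
      then show ?thesis using blk[of 1] s1 E by (simp add: u_def)
    next
      case False
      then obtain m where m: "n = Suc m" "m \<ge> 1"
        using n by (cases n) auto
      have "real E ^ n * s n = real E * (s m - s n)"
        using s_diff[OF m(2)] m(1) by simp
      then show ?thesis using blk[OF n] m by (simp add: u_def right_diff_distrib)
    qed
  next
    have "(\<lambda>n. u (Suc (Suc n))) = (\<lambda>n. real E * s (Suc n))"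
      by (simp add: u_def)
    also have "\<dots> \<longlonglongrightarrow> real E * 0"
      by (intro tendsto_mult_left) (use s_lim in \<open>simp add: filterlim_sequentially_Suc\<close>)
    finally show "u \<longlonglongrightarrow> 0"
      by (simp add: filterlim_sequentially_Suc filterlim_sequentially_Suc[of "\<lambda>n. u (Suc n)"])
  qed
  then show "stochastic_row p"
    using p_nonneg level_tail_one[OF E] by (simp add: stochastic_row_def u_def)
  show "row_times p (P_mat E) j = p j" if j: "j \<ge> 1"
  proof -
    \<comment> \<open>Here the tail masses are \<open>s\<close> itself: block \<open>n\<close>
      contributes \<open>real E ^ n * s n / (real E ^ n + 1)\<close>, which equals
      \<open>real E ^ n * s (Suc n)\<close> and so \<open>s n - s (Suc n)\<close>.\<close>
    have "((\<lambda>i. p i / (real E ^ ell i E + 1)) has_sum s (ell (j - 1) E)) (level_tail E (ell (j - 1) E))"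
    proof (rule has_sum_level_tail_telescope[OF E _ _ s_lim])
      fix n assume "ell (j - 1) E \<le> n"
      then have n: "n \<ge> 1" using ell_in(1)[OF E, of "j - 1"] by linarith
      have "(\<Sum>i\<in>level_block E n. p i / (real E ^ ell i E + 1)) = sum p (level_block E n) / (real E ^ n + 1)"
        unfolding sum_divide_distrib by (intro sum.cong) (auto simp: level_block_def)
      also have "\<dots> = s n - s (Suc n)"
        using blk[OF n] s[OF n] s_diff[OF n] by simp
      finally show "(\<Sum>i\<in>level_block E n. p i / (real E ^ ell i E + 1)) = s n - s (Suc n)" .
    qed (use p_nonneg in simp)
    then show ?thesis
      using row_times_P_mat[OF E j] p[OF j] by (simp add: infsumI)
  qed
qed

text \<open>Rows are identified when they agree on positive indices, so properties must be
  transferred without any knowledge of the value at 0.\<close>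

lemma stochastic_row_cong:
  assumes "\<And>k. k \<ge> 1 \<Longrightarrow> r k = p k"
  shows "stochastic_row r \<longleftrightarrow> stochastic_row p"
  using has_sum_cong[of "{1..}" r p] assms by (simp add: stochastic_row_def)

lemma row_times_cong:
  assumes "\<And>k. k \<ge> 1 \<Longrightarrow> r k = p k"
  shows "row_times r P = row_times p P"
  unfolding row_times_def by (intro ext infsum_cong) (simp add: assms)

section \<open>Existence and uniqueness\<close>

theorem theorem6p9:
  fixes E :: nat and q :: "nat \<Rightarrow> real"
  assumes "E \<ge> 2"
    and "q 1 = 1 / 2"
    and "\<And>k. k \<ge> 1 \<Longrightarrow> q (k + 1) = real E / (real E ^ k + 1) * q k"
  shows "\<exists>p :: nat \<Rightarrow> real.
           (\<forall>k\<in>{1..E + 1}. p k = 1 / (2 * real E)) \<and>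
           (\<forall>n>1. \<forall>k\<in>{E ^ (n - 1) + 2..E ^ n + 1}. p k = 1 / real E ^ n * q n) \<and>
           (\<forall>r. (stochastic_row r \<and> (\<forall>j\<ge>1. r j = row_times r (P_mat E) j))
                 \<longleftrightarrow> (\<forall>k\<ge>1. r k = p k)) \<and>
           (\<forall>r. stationary_distribution (P_mat E) r \<longleftrightarrow> (\<forall>k\<ge>1. r k = p k))"
proof -
  note E = assms(1)
  \<comment> \<open>Dividing by \<open>real E ^ n\<close> absorbs the factor \<open>real E\<close>
    in the recurrence of \<open>q\<close> and leaves the level recurrence.\<close>
  define s where "s n = q n / real E ^ n" for n
  define p where "p k = s (ell (k - 1) E)" for k
  have s1: "s 1 = 1 / (2 * real E)"
    unfolding s_def assms(2) by simp
  have s: "s (Suc n) = s n / (real E ^ n + 1)" if "n \<ge> 1" for n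
    using assms(3)[OF that] E by (simp add: s_def)
  note p_inv = level_row_invariant[OF E s1 s p_def]
  have unique: "(stochastic_row r \<and> (\<forall>j\<ge>1. r j = row_times r (P_mat E) j)) \<longleftrightarrow> (\<forall>k\<ge>1. r k = p k)" for r
  proof (intro iffI)
    assume "\<forall>k\<ge>1. r k = p k"
    then show "stochastic_row r \<and> (\<forall>j\<ge>1. r j = row_times r (P_mat E) j)"
      using p_inv stochastic_row_cong[of r p] row_times_cong[of r p] by simp
  next
    assume r: "stochastic_row r \<and> (\<forall>j\<ge>1. r j = row_times r (P_mat E) j)"
    then obtain t where t: "\<And>k. k \<ge> 1 \<Longrightarrow> r k = t (ell (k - 1) E)"
      "\<And>n. n \<ge> 1 \<Longrightarrow> t (Suc n) = t n / (real E ^ n + 1)"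
      using invariant_row_levels[OF E, of r] by blast
    \<comment> \<open>Since \<open>s 1\<close> is nonzero, \<open>c\<close> matches the two
      solutions at level 1, hence at all levels. Comparing total masses then forces
      \<open>c = 1\<close>.\<close>
    define c where "c = t 1 / s 1"
    have "t n = c * s n" if "n \<ge> 1" for n
      by (rule level_recurrence_proportional[where a = "\<lambda>n. real E ^ n + 1"])
        (use t(2) s s1 E that in \<open>simp_all add: c_def\<close>)
    then have rc: "r k = c * p k" if "k \<ge> 1" for k
      using t(1)[OF that] ell_in(1)[OF E] by (simp add: p_def)
    have "((\<lambda>k. c * p k) has_sum c * 1) {1..}"
      using p_inv(1) by (intro has_sum_cmult_right) (simp add: stochastic_row_def)
    moreover have "((\<lambda>k. c * p k) has_sum 1) {1..}"
      using r has_sum_cong[of "{1..}" r "\<lambda>k. c * p k"] rc by (simp add: stochastic_row_def)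
    ultimately have "c = 1"
      using has_sum_unique by fastforce
    then show "\<forall>k\<ge>1. r k = p k" using rc by simp
  qed
  show ?thesis
  proof (intro exI[of _ p] conjI ballI allI impI)
    show "p k = 1 / (2 * real E)" if "k \<in> {1..E + 1}" for k
      using that s1 ell_eq_one[OF E, of "k - 1"] by (auto simp: p_def)
    show "p k = 1 / real E ^ n * q n" if n: "n > 1" and k: "k \<in> {E ^ (n - 1) + 2..E ^ n + 1}" for n k
    proof -
      have "ell (k - 1) E = Suc (n - 1)"
        using n k by (intro ell_eq_Suc[OF E]) auto
      then show ?thesis using n by (simp add: p_def s_def)
    qed
    show "stationary_distribution (P_mat E) r \<longleftrightarrow> (\<forall>k\<ge>1. r k = p k)" for r
      unfolding unique[of r, symmetric]
      by (auto simp: stationary_distribution_def stochastic_matrix_P_mat)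
  qed (rule unique)
qed

end
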